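(* Let $\alpha_1,\alpha_2,\beta>-1$ with $\alpha_1-\alpha_2\notin\mathbb Z$, and let $(n_1,n_2)\in\mathbb N_0^2$. Let $P^{(1)}_{(n_1,n_2)},P^{(2)}_{(n_1,n_2)}$ be the Jacobi–Piñeiro multiple orthogonal polynomials of type I (for the weights $x^{\alpha_1},x^{\alpha_2}$ and the measure $(1-x)^\beta\,dx$ on $[0,1]$) biorthogonal to the monic Jacobi–Piñeiro polynomials of type II. Then, for $a\in\{1,2\}$, $$P^{(a)}_{(n_1,n_2)}(x)=(-1)^{n_1+n_2-1}\frac{(\alpha_1+\beta+n_1+n_2)_{n_1}(\alpha_2+\beta+n_1+n_2)_{n_2}}{(n_a-1)!\,(\hat\alpha_a-\alpha_a)_{\hat n_a}}\,\frac{\Gamma(\alpha_a+\beta+n_1+n_2)}{\Gamma(\beta+n_1+n_2)\,\Gamma(\alpha_a+1)}\;{}_3F_2\!\left[{-n_a+1,\ \alpha_a+\beta+n_1+n_2,\ \alpha_a-\hat\alpha_a-\hat n_a+1\atop \alpha_a+1,\ \alpha_a-\hat\alpha_a+1};x\right],$$ that is, $$P^{(a)}_{(n_1,n_2)}(x)=(-1)^{n_1+n_2-1}\frac{(\alpha_1+\beta+n_1+n_2)_{n_1}(\alpha_2+\beta+n_1+n_2)_{n_2}}{(n_a-1)!\,(\hat\alpha_a-\alpha_a)_{\hat n_a}}\,\frac{\Gamma(\alpha_a+\beta+n_1+n_2)}{\Gamma(\beta+n_1+n_2)\,\Gamma(\alpha_a+1)}\sum_{l=0}^{n_a-1}\frac{(-n_a+1)_l\,(\alpha_a+\beta+n_1+n_2)_l\,(\alpha_a-\hat\alpha_a-\hat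 n_a+1)_l}{l!\,(\alpha_a+1)_l\,(\alpha_a-\hat\alpha_a+1)_l}\,x^l.$$
   Context: Pochhammer symbol: $(x)_0=1$, $(x)_n=x(x+1)\cdots(x+n-1)$. Generalized hypergeometric series: ${}_3F_2\left[{a_1,a_2,a_3\atop b_1,b_2};x\right]=\sum_{l\ge0}\frac{(a_1)_l(a_2)_l(a_3)_l}{(b_1)_l(b_2)_l}\frac{x^l}{l!}$. Notation: $\hat\alpha_1=\alpha_2$, $\hat\alpha_2=\alpha_1$, $\hat n_1=n_2$, $\hat n_2=n_1$. The type II polynomial $P_{(m_1,m_2)}$, $(m_1,m_2)\in\mathbb N_0^2$, is the monic polynomial of degree $m_1+m_2$ with $\int_0^1x^jP_{(m_1,m_2)}(x)\,x^{\alpha_a}(1-x)^\beta\,dx=0$ for $j\in\{0,\dots,m_a-1\}$, $a\in\{1,2\}$. The type I polynomials biorthogonal to them have $\deg P^{(a)}_{(n_1,n_2)}\le n_a-1$ and satisfy $$\int_0^1x^j\big(P^{(1)}_{(n_1,n_2)}(x)x^{\alpha_1}+P^{(2)}_{(n_1,n_2)}(x)x^{\alpha_2}\big)(1-x)^\beta\,dx=0,\quad j\in\{0,\dots,n_1+n_2-2\},$$ and $$\int_0^1P_{(m_1,m_2)}(x)\big(P^{(1)}_{(n_1,n_2)}(x)x^{\alpha_1}+P^{(2)}_{(n_1,n_2)}(x)x^{\alpha_2}\big)(1-x)^\beta\,dx=\begin{cases}0,&n_1\le m_1,\ n_2\le m_2,\\1,&m_1+m_2=n_1+n_2-1,\\0,&m_1+m_2\le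 n_1+n_2-2.\end{cases}$$
   Formalization: Where the printed formula is undefined it is read by its natural value: for n_a=0, 1/(n_a-1)! is taken as 0 (so the polynomial is 0); for n_a=1, the other index 0 and α_a+β+1=0, the prefactor (which contains 0·Γ(0)) is replaced by its limit in α_a. *)

theory Defs
  imports "HOL-Analysis.Analysis" "HOL-Computational_Algebra.Polynomial"
begin

definition hypergeo_3F2 :: "real \<Rightarrow> real \<Rightarrow> real \<Rightarrow> real \<Rightarrow> real \<Rightarrow> real \<Rightarrow> real" where
  "hypergeo_3F2 a1 a2 a3 b1 b2 x =
     (\<Sum>l. pochhammer a1 l * pochhammer a2 l * pochhammer a3 l /
           (pochhammer b1 l * pochhammer b2 l) * (x ^ l / fact l))"

definition jp_type_II ::
  "real \<Rightarrow> real \<Rightarrow> real \<Rightarrow> nat \<Rightarrow> nat \<Rightarrow> real poly \<Rightarrow> bool" where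
  "jp_type_II \<alpha>1 \<alpha>2 \<beta> m1 m2 P \<longleftrightarrow>
     lead_coeff P = 1 \<and> degree P = m1 + m2 \<and>
     (\<forall>j<m1. integral {0..1} (\<lambda>x. x ^ j * poly P x * x powr \<alpha>1 * (1 - x) powr \<beta>) = 0) \<and>
     (\<forall>j<m2. integral {0..1} (\<lambda>x. x ^ j * poly P x * x powr \<alpha>2 * (1 - x) powr \<beta>) = 0)"

(* The degree bound n_a - 1 is -1 when n_a = 0, which forces P_a = 0.  The index conditions
   j <= n1 + n2 - 2, m1 + m2 = n1 + n2 - 1 and m1 + m2 <= n1 + n2 - 2 over the integers are
   written without subtraction. *)
definition jp_type_I ::
  "real \<Rightarrow> real \<Rightarrow> real \<Rightarrow> nat \<Rightarrow> nat \<Rightarrow> real poly \<Rightarrow> real poly \<Rightarrow> bool" where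
  "jp_type_I \<alpha>1 \<alpha>2 \<beta> n1 n2 P1 P2 \<longleftrightarrow>
     (P1 = 0 \<or> degree P1 < n1) \<and> (P2 = 0 \<or> degree P2 < n2) \<and>
     (\<forall>j. j + 2 \<le> n1 + n2 \<longrightarrow>
        integral {0..1} (\<lambda>x. x ^ j * (poly P1 x * x powr \<alpha>1 + poly P2 x * x powr \<alpha>2)
                              * (1 - x) powr \<beta>) = 0) \<and>
     (\<forall>m1 m2 P. jp_type_II \<alpha>1 \<alpha>2 \<beta> m1 m2 P \<longrightarrow>
        (let I = integral {0..1} (\<lambda>x. poly P x * (poly P1 x * x powr \<alpha>1 + poly P2 x * x powr \<alpha>2)
                                     * (1 - x) powr \<beta>)
         in (n1 \<le> m1 \<and> n2 \<le> m2 \<longrightarrow> I = 0) \<and>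
            (m1 + m2 + 1 = n1 + n2 \<longrightarrow> I = 1) \<and>
            (m1 + m2 + 2 \<le> n1 + n2 \<longrightarrow> I = 0)))"

(* 1 / (n - 1)!, with the usual convention 1 / (-1)! = 1 / Gamma 0 = 0 *)
definition inv_fact_pred :: "nat \<Rightarrow> real" where
  "inv_fact_pred n = (if n = 0 then 0 else 1 / fact (n - 1))"

(* \<alpha>, n stand for \<alpha>_a, n_a and \<alpha>', n' for their hatted versions; the product
   of the two Pochhammer symbols in the numerator is symmetric under exchanging the two pairs. *)
definition jp_raw_prefactor :: "real \<Rightarrow> real \<Rightarrow> real \<Rightarrow> nat \<Rightarrow> nat \<Rightarrow> real" where
  "jp_raw_prefactor \<alpha> \<alpha>' \<beta> n n' =
     (-1) powi (int n + int n' - 1) *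
     (pochhammer (\<alpha> + \<beta> + real n + real n') n * pochhammer (\<alpha>' + \<beta> + real n + real n') n') *
     inv_fact_pred n / pochhammer (\<alpha>' - \<alpha>) n' *
     (Gamma (\<alpha> + \<beta> + real n + real n') / (Gamma (\<beta> + real n + real n') * Gamma (\<alpha> + 1)))"

(* For \<alpha>, \<beta> > -1 and n \<ge> 1 the argument of the Gamma function in the numerator is a
   pole only if n = 1, n' = 0 and \<alpha> + \<beta> + 1 = 0.  The Pochhammer factor vanishes there too, so
   that the singularity is removable and the prefactor is read as its limit.
   (Gamma is 0 at its poles in the library, so the raw expression would be 0.) *)
definition jp_prefactor :: "real \<Rightarrow> real \<Rightarrow> real \<Rightarrow> nat \<Rightarrow> nat \<Rightarrow> real" where
  "jp_prefactor \<alpha> \<alpha>' \<beta> n n' =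
     (if \<alpha> + \<beta> + real n + real n' \<in> \<int>\<^sub>\<le>\<^sub>0
      then Lim (at \<alpha>) (\<lambda>t. jp_raw_prefactor t \<alpha>' \<beta> n n')
      else jp_raw_prefactor \<alpha> \<alpha>' \<beta> n n')"

definition jp_explicit_3F2 :: "real \<Rightarrow> real \<Rightarrow> real \<Rightarrow> nat \<Rightarrow> nat \<Rightarrow> real \<Rightarrow> real" where
  "jp_explicit_3F2 \<alpha> \<alpha>' \<beta> n n' x =
     jp_prefactor \<alpha> \<alpha>' \<beta> n n' *
     hypergeo_3F2 (- real n + 1) (\<alpha> + \<beta> + real n + real n') (\<alpha> - \<alpha>' - real n' + 1)
                  (\<alpha> + 1) (\<alpha> - \<alpha>' + 1) x"

definition jp_explicit_sum :: "real \<Rightarrow> real \<Rightarrow> real \<Rightarrow> nat \<Rightarrow> nat \<Rightarrow> real \<Rightarrow> real" where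
  "jp_explicit_sum \<alpha> \<alpha>' \<beta> n n' x =
     jp_prefactor \<alpha> \<alpha>' \<beta> n n' *
     (\<Sum>l<n. pochhammer (- real n + 1) l * pochhammer (\<alpha> + \<beta> + real n + real n') l
              * pochhammer (\<alpha> - \<alpha>' - real n' + 1) l
            / (fact l * pochhammer (\<alpha> + 1) l * pochhammer (\<alpha> - \<alpha>' + 1) l) * x ^ l)"

end

theory Submission
  imports Defs
begin

text \<open>
  Write \<open>m = n1 + n2 - 1\<close>. Integrating a type I linear form against a polynomial \<open>q\<close> of degree at
  most \<open>m\<close> gives the coefficient of \<open>x^m\<close> in \<open>q\<close>. Conversely, the Jacobi moments of such a \<open>q\<close>
  against \<open>x^s (1 - x)^\<beta>\<close> are \<open>\<Gamma>(s + 1) \<Gamma>(\<beta> + 1) / \<Gamma>(s + \<beta> + m + 2)\<close> times a polynomial \<open>r(s)\<close> of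
  degree at most \<open>m\<close>, every such \<open>r\<close> occurs, and the leading coefficient of \<open>q\<close> can be read off from
  \<open>r(- \<beta> - m - 1)\<close>. Letting \<open>r\<close> vanish at all the exponents \<open>\<alpha>1 + i\<close>, \<open>\<alpha>2 + i\<close> of the linear form
  except one therefore isolates a single coefficient of a type I polynomial as a quotient of two
  values of \<open>r\<close>. The normalisation of the form uses only the type II polynomial with index \<open>(m, 0)\<close>.
\<close>

section \<open>Expansion of polynomials in Pochhammer products\<close>

text \<open>The products on the right are the moments of \<open>x^j\<close> with their common Gamma
  factor removed. Induction on \<open>m\<close>: subtracting the top term leaves a multiple of a
  linear factor that all other products share, and \<open>b > -1\<close> keeps the top product
  nonzero at its root.\<close>

lemma pochhammer_basis_expansion:
  fixes b :: real and r :: "real poly"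
  assumes b: "b > -1" and "degree r \<le> m"
  shows "\<exists>q. degree q \<le> m \<and>
    (\<forall>s. poly r s = (\<Sum>j\<le>m. coeff q j * (pochhammer (s + 1) j * pochhammer (s + b + 2 + real j) (m - j))))"
  using assms(2)
proof (induction m arbitrary: r)
  case 0
  then obtain c where "r = [:c:]" by (metis degree_eq_zeroE le_zero_eq)
  then show ?case by (intro exI[of _ "[:c:]"]) auto
next
  case (Suc m)
  \<comment> \<open>At \<open>t\<close> every term with \<open>j \<le> m\<close> vanishes, which determines the top coefficient.\<close>
  define t where "t = - b - real m - 2"
  define p where "p = (\<Prod>i\<le>m. [:1 + real i, 1:])"
  have poly_p: "poly p s = pochhammer (s + 1) (Suc m)" for s
    by (simp add: p_def poly_prod pochhammer_prod atLeast0AtMost lessThan_Suc_atMost[symmetric]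
        atLeast0LessThan algebra_simps)
  have deg_p: "degree p \<le> Suc m"
    unfolding p_def by (rule order_trans[OF degree_prod_sum_le]) auto
  have nz: "poly p t \<noteq> 0"
    unfolding poly_p using b by (auto simp: pochhammer_eq_0_iff t_def)
  define c where "c = poly r t / poly p t"
  have "poly (r - smult c p) t = 0" using nz by (simp add: c_def)
  then obtain u where u: "r - smult c p = [:-t, 1:] * u"
    by (metis poly_eq_0_iff_dvd dvdE)
  have "degree (r - smult c p) \<le> Suc m"
    using Suc.prems deg_p by (intro degree_diff_le) (auto intro: order_trans[OF degree_smult_le])
  then have "degree u \<le> m"
    unfolding u by (cases "u = 0") (simp_all add: degree_mult_eq del: mult_pCons_left)
  from Suc.IH[OF this] obtain q where dq: "degree q \<le> m" and q:
    "\<And>s. poly u s = (\<Sum>j\<le>m. coeff q j * (pochhammer (s + 1) j * pochhammer (s + b + 2 + real j) (m - j)))"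
    by auto
  define q' where "q' = q + monom c (Suc m)"
  have coeff_q': "coeff q' j = coeff q j" if "j \<le> m" for j
    using that by (simp add: q'_def)
  have coeff_q'_top: "coeff q' (Suc m) = c"
    using dq by (simp add: q'_def coeff_eq_0)
  have "poly r s = (\<Sum>j\<le>Suc m. coeff q' j *
          (pochhammer (s + 1) j * pochhammer (s + b + 2 + real j) (Suc m - j)))" for s
  proof -
    \<comment> \<open>Raising \<open>m\<close> by one appends the factor
      \<open>s + b + 2 + real m = s - t\<close>, the same for every \<open>j\<close>.\<close>
    have "pochhammer (s + b + 2 + real j) (Suc m - j)
            = pochhammer (s + b + 2 + real j) (m - j) * (s - t)" if "j \<le> m" for j
      using that by (simp add: Suc_diff_le pochhammer_Suc t_def of_nat_diff algebra_simps)
    then have "(\<Sum>j\<le>m. coeff q' j * (pochhammer (s + 1) j * pochhammer (s + b + 2 + real j) (Suc m - j)))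
            = (s - t) * poly u s"
      by (auto simp: q sum_distrib_left coeff_q' intro!: sum.cong)
    moreover have "poly r s = c * poly p s + (s - t) * poly u s"
      using arg_cong[OF u, of "\<lambda>v. poly v s"] by (simp add: algebra_simps)
    ultimately show ?thesis by (simp add: coeff_q'_top poly_p)
  qed
  moreover have "degree q' \<le> Suc m"
    unfolding q'_def using dq by (intro degree_add_le) (auto intro: order_trans[OF degree_monom_le])
  ultimately show ?case by blast
qed

section \<open>Jacobi integrals of polynomials\<close>

lemma power_mult_powr:
  fixes x :: real
  assumes "x \<ge> 0"
  shows "x ^ j * x powr a = x powr (a + real j)"
  \<comment> \<open>At \<open>x = 0\<close> both sides are \<open>0\<close>, because
    \<open>0 powr a = 0\<close> for every \<open>a\<close>.\<close>
  using assms by (cases "x = 0") (auto simp: powr_add powr_realpow)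

definition jacobi_integral :: "real \<Rightarrow> real \<Rightarrow> real poly \<Rightarrow> real" where
  "jacobi_integral a b p = integral {0..1} (\<lambda>x. poly p x * x powr a * (1 - x) powr b)"

lemma has_integral_jacobi_monomial:
  fixes a b :: real
  assumes "a > -1" "b > -1"
  shows "((\<lambda>x. x ^ j * x powr a * (1 - x) powr b) has_integral Beta (a + real j + 1) (b + 1)) {0..1}"
proof -
  have "((\<lambda>x. x powr (a + real j + 1 - 1) * (1 - x) powr (b + 1 - 1))
          has_integral Beta (a + real j + 1) (b + 1)) {0..1}"
    using assms by (intro has_integral_Beta_real) auto
  then show ?thesis
    by (rule has_integral_eq[rotated]) (simp add: power_mult_powr)
qed

lemma jacobi_integrable:
  fixes a b :: real
  assumes "a > -1" "b > -1"
  shows "(\<lambda>x. poly p x * x powr a * (1 - x) powr b) integrable_on {0..1}"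
proof -
  have "(\<lambda>x. \<Sum>j\<le>degree p. coeff p j * (x ^ j * x powr a * (1 - x) powr b)) integrable_on {0..1}"
    using has_integral_jacobi_monomial[OF assms]
    by (intro integrable_sum integrable_on_mult_right) (auto simp: integrable_on_def)
  then show ?thesis
    by (simp add: poly_altdef sum_distrib_right mult.assoc)
qed

lemma jacobi_integral_linear:
  assumes "a > -1" "b > -1"
  shows jacobi_integral_add: "jacobi_integral a b (p + q) = jacobi_integral a b p + jacobi_integral a b q"
    and jacobi_integral_smult: "jacobi_integral a b (smult c p) = c * jacobi_integral a b p"
  using integral_add[OF jacobi_integrable[OF assms, of p] jacobi_integrable[OF assms, of q]]
  by (simp_all add: jacobi_integral_def algebra_simps flip: integral_mult_right)

lemma jacobi_integral_sum:
  assumes "a > -1" "b > -1" "finite A"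
  shows "jacobi_integral a b (\<Sum>j\<in>A. smult (c j) (p j)) = (\<Sum>j\<in>A. c j * jacobi_integral a b (p j))"
  using assms(3)
  by (induction A rule: finite_induct)
     (simp_all add: jacobi_integral_linear[OF assms(1,2)], simp add: jacobi_integral_def)

lemma poly_eq_sum_smult_monom:
  fixes p :: "real poly"
  assumes "degree p \<le> m"
  shows "p = (\<Sum>j\<le>m. smult (coeff p j) (monom 1 j))"
  using poly_as_sum_of_monoms'[OF assms] by (simp only: smult_monom mult_1_right)

lemma jacobi_integral_mult_expand:
  assumes "a > -1" "b > -1" "degree q \<le> m"
  shows "jacobi_integral a b (q * p) = (\<Sum>j\<le>m. coeff q j * jacobi_integral a b (monom 1 j * p))"
proof -
  have "q * p = (\<Sum>j\<le>m. smult (coeff q j) (monom 1 j * p))"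
    by (subst poly_eq_sum_smult_monom[OF assms(3)]) (simp add: sum_distrib_right)
  then show ?thesis by (simp only: jacobi_integral_sum[OF assms(1,2) finite_atMost])
qed

lemma jacobi_integral_mult_monom:
  "jacobi_integral a b (monom 1 i * p) = jacobi_integral (a + real i) b p"
  unfolding jacobi_integral_def
  by (rule integral_cong) (simp add: poly_monom mult_ac flip: power_mult_powr)

text \<open>The Beta value is put over a denominator independent of \<open>j\<close>; what remains
  is a polynomial in \<open>a\<close> of degree \<open>m\<close>.\<close>

lemma jacobi_integral_monom:
  fixes a b :: real
  assumes "a > -1" "b > -1" "j \<le> m"
  shows "jacobi_integral a b (monom 1 j) = Gamma (a + 1) * Gamma (b + 1) / Gamma (a + b + real m + 2) *
           (pochhammer (a + 1) j * pochhammer (a + b + 2 + real j) (m - j))"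
proof -
  have "jacobi_integral a b (monom 1 j) = Beta (a + real j + 1) (b + 1)"
    using integral_unique[OF has_integral_jacobi_monomial[OF assms(1,2)]]
    by (simp add: jacobi_integral_def poly_monom)
  moreover have "pochhammer (a + 1) j = Gamma (a + 1 + real j) / Gamma (a + 1)"
    using assms by (intro pochhammer_Gamma) (auto elim!: nonpos_Ints_cases)
  moreover have "pochhammer (a + b + 2 + real j) (m - j)
      = Gamma (a + b + 2 + real j + real (m - j)) / Gamma (a + b + 2 + real j)"
    using assms by (intro pochhammer_Gamma) (auto elim!: nonpos_Ints_cases)
  moreover have "Gamma (a + 1) > 0" "Gamma (a + b + 2 + real m) > 0"
    using assms by (auto intro!: Gamma_real_pos)
  ultimately show ?thesis
    using assms(3) by (simp add: Beta_def of_nat_diff add_ac)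
qed

text \<open>The expansion of \<open>r\<close> supplies the coefficients of \<open>q\<close>, and
  summing the monomial moments gives back \<open>r\<close>. At \<open>s = - b - real m - 1\<close>
  only the top term survives, so \<open>r\<close> also controls the leading coefficient.\<close>

lemma prescribed_jacobi_integrals:
  fixes b :: real
  assumes b: "b > -1" and "degree r \<le> m"
  obtains q where "degree q \<le> m"
    and "coeff q m * pochhammer (- b - real m) m = poly r (- b - real m - 1)"
    and "\<And>s. s > -1 \<Longrightarrow> jacobi_integral s b q
           = Gamma (s + 1) * Gamma (b + 1) / Gamma (s + b + real m + 2) * poly r s"
proof -
  obtain q where dq: "degree q \<le> m" and q: "\<And>s. poly r s =
      (\<Sum>j\<le>m. coeff q j * (pochhammer (s + 1) j * pochhammer (s + b + 2 + real j) (m - j)))"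
    using pochhammer_basis_expansion[OF assms] by blast
  \<comment> \<open>The factors run from \<open>1 + real j - real m\<close> up to
    \<open>0\<close>.\<close>
  have "pochhammer (1 + real j - real m) (m - j) = 0" if "j < m" for j
    using that by (auto simp: pochhammer_eq_0_iff of_nat_diff intro!: exI[of _ "m - j - 1"])
  then have "poly r (- b - real m - 1)
      = (\<Sum>j\<in>{m}. coeff q j * (pochhammer (- b - real m) j
          * pochhammer (1 + real j - real m) (m - j)))"
    unfolding q by (intro sum.mono_neutral_cong_right) (auto simp: algebra_simps)
  moreover have "jacobi_integral s b q
      = Gamma (s + 1) * Gamma (b + 1) / Gamma (s + b + real m + 2) * poly r s" if "s > -1" for s
    using jacobi_integral_mult_expand[OF that b dq, of 1] jacobi_integral_monom[OF that b]
    by (simp add: q sum_distrib_left mult_ac)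
  ultimately show ?thesis using dq that by auto
qed

section \<open>Product and Gamma function identities\<close>

text \<open>The product is \<open>(-1)^(n - 1 - k) k! (n - 1 - k)!\<close>, as in Lagrange
  interpolation at \<open>0, ..., n - 1\<close>; the Pochhammer symbol is
  \<open>(-1)^k (n - 1)! / (n - 1 - k)!\<close>.\<close>

lemma prod_diff_mult_pochhammer:
  assumes "k < n"
  shows "(\<Prod>i\<in>{..<n} - {k}. real k - real i) * pochhammer (- real n + 1) k
           = (-1) ^ (n - 1) * fact k * fact (n - 1)"
proof -
  obtain l where n: "n = k + 1 + l" using assms less_iff_Suc_add by force
  have split: "{..<n} - {k} = {..<k} \<union> {k + 1..<k + 1 + l}" using n by auto
  have "(\<Prod>i\<in>{..<n} - {k}. real k - real i)
      = (\<Prod>i<k. real k - real i) * (\<Prod>i=k + 1..<k + 1 + l. real k - real i)"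
    unfolding split by (rule prod.union_disjoint) auto
  also have "(\<Prod>i<k. real k - real i) = fact k"
    unfolding fact_prod_rev by (simp add: atLeast0LessThan of_nat_diff)
  also have "(\<Prod>i=k + 1..<k + 1 + l. real k - real i) = (\<Prod>i<l. - (1 + real i))"
    by (rule prod.reindex_bij_witness[of _ "\<lambda>i. i + (k + 1)" "\<lambda>i. i - (k + 1)"]) (auto simp: of_nat_diff)
  also have "\<dots> = (-1) ^ l * fact l"
    unfolding prod_uminus by (simp add: pochhammer_fact[of l] pochhammer_prod atLeast0LessThan)
  finally have "(\<Prod>i\<in>{..<n} - {k}. real k - real i) = (-1) ^ l * fact l * fact k" by simp
  moreover have "pochhammer (- real n + 1) k = (-1) ^ k * pochhammer (real l + 1) k"
    using pochhammer_minus[of "real n - 1" k] n by (simp add: algebra_simps)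
  moreover have "fact (n - 1) = fact l * pochhammer (real l + 1) k"
    using pochhammer_product'[of "1::real" l k] n by (simp add: pochhammer_fact add_ac)
  ultimately show ?thesis using n by (simp add: power_add)
qed

text \<open>\<open>pochhammer (d - real k) (n + k)\<close> is split after \<open>n\<close> and after
  \<open>k\<close> factors. Reflecting the symbol of length \<open>k\<close> in either splitting
  costs the same sign, which cancels.\<close>

lemma pochhammer_shift_reflect:
  fixes d :: real
  shows "pochhammer (d - real k) n * pochhammer (1 - d - real n) k = pochhammer d n * pochhammer (1 - d) k"
proof -
  have "pochhammer (d - real k) n * pochhammer (d - real k + real n) k
      = pochhammer (d - real k) k * pochhammer d n"
    using pochhammer_product'[of "d - real k" n k] pochhammer_product'[of "d - real k" k n]
    by (simp add: add.commute)
  moreover have "pochhammer (d - real k + real n) k = (-1) ^ k * pochhammer (1 - d - real n) k"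
    using pochhammer_minus'[of "d + real n - 1" k] by (simp add: algebra_simps)
  moreover have "pochhammer (d - real k) k = (-1) ^ k * pochhammer (1 - d) k"
    using pochhammer_minus'[of "d - 1" k] by (simp add: algebra_simps)
  ultimately show ?thesis by (simp add: mult_ac)
qed

text \<open>
  In the case \<open>n = 1\<close>, \<open>z\<close> may be \<open>0\<close>: stating the identity with \<open>Gamma (z + 1)\<close> instead of
  \<open>z * Gamma z\<close> covers the removable singularity of the prefactor.
\<close>
lemma prod_omit_mult_Gamma:
  fixes z :: real
  assumes "k < n" and "n = 1 \<or> z > 0"
  shows "(\<Prod>i\<in>{..<n} - {k}. z + real i) * Gamma (z + real k + 1)
           = pochhammer (z + 1) (n - 1) * Gamma (z + 1) * pochhammer z k"
  using assms(2)
proof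
  assume "n = 1"
  with assms show ?thesis by simp
next
  assume z: "z > 0"
  have z': "z \<notin> \<int>\<^sub>\<le>\<^sub>0" and zk': "z + real k \<notin> \<int>\<^sub>\<le>\<^sub>0"
    using z by (auto elim!: nonpos_Ints_cases)
  have "(\<Prod>i\<in>{..<n} - {k}. z + real i) * (z + real k) = pochhammer z n"
    using assms prod.remove[of "{..<n}" k "\<lambda>i. z + real i"]
    by (simp add: pochhammer_prod atLeast0LessThan mult.commute)
  also have "\<dots> = z * pochhammer (z + 1) (n - 1)"
    using assms pochhammer_rec[of z "n - 1"] by simp
  finally have "(\<Prod>i\<in>{..<n} - {k}. z + real i) * (z + real k) = z * pochhammer (z + 1) (n - 1)" .
  moreover have "Gamma (z + real k + 1) = (z + real k) * Gamma (z + real k)"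
    "Gamma (z + 1) = z * Gamma z"
    using z' zk' by (auto intro: Gamma_plus1)
  moreover have "Gamma (z + real k) = Gamma z * pochhammer z k"
    using z' Gamma_real_pos[OF z, THEN less_imp_neq] by (simp add: pochhammer_Gamma)
  ultimately show ?thesis by (simp add: mult_ac)
qed

section \<open>Coefficients of a type I polynomial\<close>

text \<open>Two evaluations of the integral of the linear form against one polynomial
  \<open>q\<close> are compared. \<open>pochhammer (z + 1) (n - 1) * Gamma (z + 1)\<close> replaces
  \<open>pochhammer z n * Gamma z\<close>, which has a removable singularity at
  \<open>z = 0\<close>.\<close>

lemma jacobi_type_I_coeff:
  fixes \<alpha> \<alpha>' \<beta> :: real and n n' :: nat
  assumes ab: "\<alpha> > -1" "\<alpha>' > -1" "\<beta> > -1" and nonint: "\<alpha> - \<alpha>' \<notin> \<int>"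
    and degP: "degree P < n" and degP': "P' = 0 \<or> degree P' < n'"
    and moments: "\<And>j. j < n + n' \<Longrightarrow>
      jacobi_integral \<alpha> \<beta> (monom 1 j * P) + jacobi_integral \<alpha>' \<beta> (monom 1 j * P')
        = (if j + 1 = n + n' then 1 else 0)"
    and k: "k < n"
  defines "z \<equiv> \<alpha> + \<beta> + real n + real n'"
  shows "coeff P k = (-1) ^ (n + n' - 1)
      * (pochhammer (z + 1) (n - 1) * pochhammer (\<alpha>' + \<beta> + real n + real n') n')
      / (fact (n - 1) * pochhammer (\<alpha>' - \<alpha>) n')
      * (Gamma (z + 1) / (Gamma (\<beta> + real n + real n') * Gamma (\<alpha> + 1)))
      * (pochhammer (- real n + 1) k * pochhammer z k * pochhammer (\<alpha> - \<alpha>' - real n' + 1) k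
         / (fact k * pochhammer (\<alpha> + 1) k * pochhammer (\<alpha> - \<alpha>' + 1) k))"
proof -
  define m where "m = n - 1 + n'"
  have m: "real m = real n + real n' - 1" using k by (simp add: m_def of_nat_diff)
  \<comment> \<open>The roots of \<open>r\<close> are the exponents \<open>\<alpha> + i\<close> and
    \<open>\<alpha>' + i\<close> of the linear form except \<open>\<alpha> + real k\<close>; there
    are \<open>n - 1 + n' = m\<close> of them.\<close>
  define r1 where "r1 = (\<Prod>i\<in>{..<n} - {k}. [:- (\<alpha> + real i), 1:])"
  define r2 where "r2 = (\<Prod>i<n'. [:- (\<alpha>' + real i), 1:])"
  define r where "r = r1 * r2"
  have poly_r: "poly r s = (\<Prod>i\<in>{..<n} - {k}. s - (\<alpha> + real i)) * (\<Prod>i<n'. s - (\<alpha>' + real i))" for s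
    by (simp add: r_def r1_def r2_def poly_prod algebra_simps)
  have "degree r1 \<le> n - 1"
    unfolding r1_def using k by (intro order_trans[OF degree_prod_sum_le]) auto
  moreover have "degree r2 \<le> n'"
    unfolding r2_def by (intro order_trans[OF degree_prod_sum_le]) auto
  ultimately have "degree r \<le> m"
    unfolding r_def m_def by (intro order_trans[OF degree_mult_le]) simp
  from prescribed_jacobi_integrals[OF ab(3) this] obtain q where dq: "degree q \<le> m"
    and lead: "coeff q m * pochhammer (- \<beta> - real m) m = poly r (- \<beta> - real m - 1)"
    and J: "\<And>s. s > -1 \<Longrightarrow> jacobi_integral s \<beta> q
           = Gamma (s + 1) * Gamma (\<beta> + 1) / Gamma (s + \<beta> + real m + 2) * poly r s"
    by blast

  \<comment> \<open>First evaluation: expanding \<open>q\<close> leaves only the moment for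
    \<open>x^m\<close>, since the lower ones vanish.\<close>
  have "jacobi_integral \<alpha> \<beta> (q * P) + jacobi_integral \<alpha>' \<beta> (q * P')
      = (\<Sum>j\<le>m. coeff q j * (jacobi_integral \<alpha> \<beta> (monom 1 j * P)
          + jacobi_integral \<alpha>' \<beta> (monom 1 j * P')))"
    by (simp add: jacobi_integral_mult_expand[OF _ ab(3) dq] ab distrib_left sum.distrib)
  also have "\<dots> = (\<Sum>j\<in>{m}. coeff q j)"
  proof -
    have "n + n' = m + 1" using k by (simp add: m_def)
    then show ?thesis by (intro sum.mono_neutral_cong_right) (auto simp: moments)
  qed
  finally have total: "jacobi_integral \<alpha> \<beta> (q * P) + jacobi_integral \<alpha>' \<beta> (q * P') = coeff q m"
    by simp

  \<comment> \<open>Second evaluation: expanding \<open>P\<close> and \<open>P'\<close> instead,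
    each power of \<open>x\<close> shifts the exponent to a root of \<open>r\<close>, except for
    \<open>x^k\<close> in \<open>P\<close>.\<close>
  have shifted: "jacobi_integral a \<beta> (q * p) = (\<Sum>i\<le>d. coeff p i * jacobi_integral (a + real i) \<beta> q)"
    if "a > -1" "degree p \<le> d" for a p d
    using jacobi_integral_mult_expand[OF that(1) ab(3) that(2), of q]
    by (simp add: jacobi_integral_mult_monom mult.commute[of q])
  have "jacobi_integral \<alpha>' \<beta> (q * P') = 0"
  \<comment> \<open>The zero polynomial has degree \<open>0\<close>, which is not below
    \<open>n'\<close> when \<open>n' = 0\<close>.\<close>
  proof (cases "P' = 0")
    case False
    then have "jacobi_integral (\<alpha>' + real i) \<beta> q = 0" if "i \<le> degree P'" for i
      using that degP' ab by (subst J) (auto simp: poly_r)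
    then show ?thesis using shifted[OF ab(2) order_refl, of P'] by simp
  qed (simp add: jacobi_integral_def)
  moreover have "jacobi_integral \<alpha> \<beta> (q * P) = (\<Sum>i\<in>{k}. coeff P i * jacobi_integral (\<alpha> + real i) \<beta> q)"
  proof -
    have "degree P \<le> n - 1" using degP by simp
    moreover have "jacobi_integral (\<alpha> + real i) \<beta> q = 0" if "i < n" "i \<noteq> k" for i
      using that ab by (subst J) (auto simp: poly_r)
    ultimately show ?thesis
      unfolding shifted[OF ab(1) \<open>degree P \<le> n - 1\<close>]
      using k by (intro sum.mono_neutral_right) auto
  qed
  ultimately have "coeff q m = coeff P k * (Gamma (\<alpha> + real k + 1) * Gamma (\<beta> + 1)
      / Gamma (z + real k + 1) * poly r (\<alpha> + real k))"
    using total J[of "\<alpha> + real k"] ab by (simp add: m z_def algebra_simps)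
  with lead have main: "coeff P k * (Gamma (\<alpha> + real k + 1) * Gamma (\<beta> + 1)
      / Gamma (z + real k + 1) * poly r (\<alpha> + real k))
      * pochhammer (- \<beta> - real m) m = poly r (- \<beta> - real m - 1)"
    by simp

  define d where "d = \<alpha>' - \<alpha>"
  have "d \<notin> \<int>"
    using nonint by (metis Ints_minus minus_diff_eq d_def)
  then have "1 - d \<notin> \<int>" "1 - d - real n' \<notin> \<int>"
    using Ints_diff[of 1 "1 - d"] Ints_diff[of "1 - real n'" "1 - d - real n'"] by auto
  moreover have "pochhammer x i \<noteq> 0" if "x \<notin> \<int>" for x :: real and i
    using that by (auto simp: pochhammer_eq_0_iff)
  ultimately have d: "pochhammer d n' \<noteq> 0" "pochhammer (1 - d) k \<noteq> 0" "pochhammer (1 - d - real n') k \<noteq> 0"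
    using \<open>d \<notin> \<int>\<close> by blast+
  define A where "A = (\<Prod>i\<in>{..<n} - {k}. z + real i)"
  define B where "B = (\<Prod>i\<in>{..<n} - {k}. real k - real i)"
  define E where "E = pochhammer (\<alpha>' + \<beta> + real n + real n') n'"
  have card: "card ({..<n} - {k}) = n - 1" using k by simp
  have r_lower: "poly r (- \<beta> - real m - 1) = (-1) ^ m * A * E"
  proof -
    have "(\<Prod>i\<in>{..<n} - {k}. - \<beta> - real m - 1 - (\<alpha> + real i)) = (\<Prod>i\<in>{..<n} - {k}. - (z + real i))"
      by (intro prod.cong refl) (simp add: z_def m)
    also have "\<dots> = (-1) ^ (n - 1) * A" unfolding prod_uminus card A_def by simp
    finally have 1: "(\<Prod>i\<in>{..<n} - {k}. - \<beta> - real m - 1 - (\<alpha> + real i)) = (-1) ^ (n - 1) * A" .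
    have "(\<Prod>i<n'. - \<beta> - real m - 1 - (\<alpha>' + real i)) = (\<Prod>i<n'. - (\<alpha>' + \<beta> + real n + real n' + real i))"
      by (intro prod.cong refl) (simp add: m)
    also have "\<dots> = (-1) ^ n' * E"
      unfolding prod_uminus by (simp add: E_def pochhammer_prod atLeast0LessThan)
    finally show ?thesis unfolding poly_r 1 by (simp add: m_def power_add)
  qed
  have r_upper: "poly r (\<alpha> + real k) = B * ((-1) ^ n' * pochhammer (d - real k) n')"
  proof -
    have "(\<Prod>i<n'. \<alpha> + real k - (\<alpha>' + real i)) = (\<Prod>i<n'. - (d - real k + real i))"
      by (intro prod.cong refl) (simp add: d_def)
    also have "\<dots> = (-1) ^ n' * pochhammer (d - real k) n'"
      unfolding prod_uminus by (simp add: pochhammer_prod atLeast0LessThan)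
    finally show ?thesis unfolding poly_r by (simp add: B_def)
  qed
  \<comment> \<open>By reflection the symbol is \<open>(-1)^m * pochhammer (\<beta> + 1) m\<close>,
    and \<open>\<beta> + 1 + m = \<beta> + n + n'\<close>.\<close>
  have poch_beta: "pochhammer (- \<beta> - real m) m * Gamma (\<beta> + 1) = (-1) ^ m * Gamma (\<beta> + real n + real n')"
  proof -
    have "\<beta> + 1 \<notin> \<int>\<^sub>\<le>\<^sub>0" "Gamma (\<beta> + 1) > 0"
      using ab(3) by (auto elim!: nonpos_Ints_cases intro!: Gamma_real_pos)
    then have "pochhammer (\<beta> + 1) m * Gamma (\<beta> + 1) = Gamma (\<beta> + real n + real n')"
      by (simp add: pochhammer_Gamma m algebra_simps)
    moreover have "pochhammer (- \<beta> - real m) m = (-1) ^ m * pochhammer (\<beta> + 1) m"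
      using pochhammer_minus[of "\<beta> + real m" m] by (simp add: algebra_simps)
    ultimately show ?thesis by simp
  qed
  have Gamma_alpha: "Gamma (\<alpha> + real k + 1) = Gamma (\<alpha> + 1) * pochhammer (\<alpha> + 1) k"
  proof -
    have "\<alpha> + 1 \<notin> \<int>\<^sub>\<le>\<^sub>0" "Gamma (\<alpha> + 1) \<noteq> 0"
      using ab(1) Gamma_real_pos[of "\<alpha> + 1", THEN less_imp_neq] by (auto elim!: nonpos_Ints_cases)
    then show ?thesis by (simp add: pochhammer_Gamma add_ac)
  qed
  have z: "n = 1 \<or> z > 0" "z + real k + 1 > 0"
    using ab k by (auto simp: z_def)
  have pos: "Gamma (\<alpha> + 1) > 0" "Gamma (\<beta> + real n + real n') > 0" "Gamma (z + real k + 1) > 0"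
     "pochhammer (\<alpha> + 1) k > 0"
    using ab k z by (auto intro!: Gamma_real_pos pochhammer_pos)
  note AG = prod_omit_mult_Gamma[OF k z(1), folded A_def]
  note BP = prod_diff_mult_pochhammer[OF k, folded B_def]
  note DP = pochhammer_shift_reflect[of d k n']
  have sgn: "(-1 :: real) ^ m = (-1) ^ (n - 1) * (-1) ^ n'" by (simp add: m_def power_add)
  define T where "T = pochhammer (- real n + 1) k"
  define S where "S = pochhammer (1 - d - real n') k"
  define D where "D = pochhammer (d - real k) n'"
  \<comment> \<open>\<open>u\<close> and \<open>v\<close> stand for the signs
    \<open>(-1)^(n - 1)\<close> and \<open>(-1)^n'\<close> with product \<open>(-1)^m\<close>;
    having square \<open>1\<close>, they can change sides.\<close>
  have strip_signs: "c * G * (f * g) * y * h = (u * v) * e * w * t * t'"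
    if "c * G * (u * f * g) * (v * y) * h = e * w * t * t'" "u * u = 1" "v * v = 1"
    for c G f g y h u v e w t t' :: real
  proof -
    have "c * G * (f * g) * y * h = (u * u) * (v * v) * (c * G * (f * g) * y * h)"
      by (simp add: that(2,3))
    also have "\<dots> = (u * v) * (c * G * (u * f * g) * (v * y) * h)"
      by (simp only: mult_ac)
    finally show ?thesis unfolding that(1) by (simp only: mult.assoc)
  qed
  have "coeff P k * Gamma (\<alpha> + real k + 1) * B * ((-1) ^ n' * D)
          * (pochhammer (- \<beta> - real m) m * Gamma (\<beta> + 1)) = (-1) ^ m * A * E * Gamma (z + real k + 1)"
  proof -
    have "c * G * R * t * (p * g) = L * h" if "c * (G * g / h * (R * t)) * p = L" "h > 0"
      for c G g h R t p L :: real
      unfolding that(1)[symmetric] using that(2) by simp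
    from this[OF main[unfolded r_lower r_upper] pos(3)] show ?thesis by (simp only: D_def)
  qed
  then have "coeff P k * Gamma (\<alpha> + real k + 1) * B * ((-1) ^ n' * D) * Gamma (\<beta> + real n + real n')
      = E * (A * Gamma (z + real k + 1))"
    unfolding poch_beta by (simp add: mult_ac)
  \<comment> \<open>\<open>T\<close> and \<open>S\<close> complete \<open>B\<close> and
    \<open>D\<close> to the products evaluated by \<open>BP\<close> and \<open>DP\<close>, and
    remain on the right as numerators of the claim.\<close>
  from arg_cong[OF this, of "\<lambda>x. x * (T * S)"]
  have "coeff P k * Gamma (\<alpha> + real k + 1) * (B * T) * ((-1) ^ n' * (D * S))
        * Gamma (\<beta> + real n + real n')
      = E * (A * Gamma (z + real k + 1)) * T * S"
    by (simp only: mult_ac)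
  then have coeff_eq: "coeff P k * (Gamma (\<alpha> + 1) * pochhammer (\<alpha> + 1) k) * (fact k * fact (n - 1))
        * (pochhammer d n' * pochhammer (1 - d) k) * Gamma (\<beta> + real n + real n')
      = (-1) ^ m * E * (pochhammer (z + 1) (n - 1) * Gamma (z + 1) * pochhammer z k) * T * S"
    unfolding AG Gamma_alpha BP[folded T_def] DP[folded D_def S_def] sgn
    by (rule strip_signs) (simp_all flip: power_mult_distrib)
  have normalized: "n + n' - 1 = m" "\<alpha> - \<alpha>' - real n' + 1 = 1 - d - real n'"
    "\<alpha> - \<alpha>' + 1 = 1 - d" "\<alpha>' - \<alpha> = d"
    using k by (auto simp: m_def d_def)
  have nz: "Gamma (\<alpha> + 1) \<noteq> 0" "Gamma (\<beta> + real n + real n') \<noteq> 0" "pochhammer (\<alpha> + 1) k \<noteq> 0"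
    using pos(1,2,4)[THEN less_imp_neq, THEN not_sym] .
  have solve: "X = s * (e1 * E) / (nf * pd) * (Gz / (Gb * Ga)) * (T * pz * S / (kf * pa * pd'))"
    if "X * (Ga * pa) * (kf * nf) * (pd * pd') * Gb = s * E * (e1 * Gz * pz) * T * S"
      "Ga \<noteq> 0" "pa \<noteq> 0" "kf \<noteq> 0" "nf \<noteq> 0" "pd \<noteq> 0" "pd' \<noteq> 0" "Gb \<noteq> 0"
    for X s e1 E nf pd Gz Gb Ga T pz S kf pa pd' :: real
  proof -
    have "X = s * E * (e1 * Gz * pz) * T * S / ((Ga * pa) * (kf * nf) * (pd * pd') * Gb)"
      unfolding that(1)[symmetric] using that(2-) by simp
    then show ?thesis by (simp only: times_divide_times_eq mult_ac)
  qed
  show ?thesis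
    unfolding normalized
    by (rule solve[OF coeff_eq[unfolded E_def T_def S_def] nz(1,3) fact_nonzero fact_nonzero d(1,2) nz(2)])
qed

section \<open>Moments of the type I linear form\<close>

text \<open>With second index \<open>0\<close> this is the classical Jacobi polynomial on the unit
  interval, made monic. Letting \<open>r\<close> vanish at \<open>\<alpha> + j\<close> for
  \<open>j < m\<close> gives orthogonality.\<close>

lemma monic_jacobi_exists:
  fixes \<alpha> \<beta> :: real
  assumes "\<alpha> > -1" "\<beta> > -1"
  obtains p where "jp_type_II \<alpha> \<alpha>' \<beta> m 0 p"
proof -
  define r where "r = (\<Prod>i<m. [:- (\<alpha> + real i), 1:])"
  have poly_r: "poly r s = (\<Prod>i<m. s - (\<alpha> + real i))" for s
    by (simp add: r_def poly_prod algebra_simps)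
  have "degree r \<le> m"
    unfolding r_def by (intro order_trans[OF degree_prod_sum_le]) auto
  from prescribed_jacobi_integrals[OF assms(2) this] obtain q where dq: "degree q \<le> m"
    and lead: "coeff q m * pochhammer (- \<beta> - real m) m = poly r (- \<beta> - real m - 1)"
    and J: "\<And>s. s > -1 \<Longrightarrow> jacobi_integral s \<beta> q
           = Gamma (s + 1) * Gamma (\<beta> + 1) / Gamma (s + \<beta> + real m + 2) * poly r s"
    by blast
  \<comment> \<open>The factors are \<open>- (\<alpha> + \<beta> + m + 1 + i)\<close>; they occur
    only for \<open>m \<ge> 1\<close> and are then negative.\<close>
  have "poly r (- \<beta> - real m - 1) \<noteq> 0"
    using assms by (auto simp: poly_r)
  then have nz: "coeff q m \<noteq> 0" using lead by auto
  then have deg: "degree q = m" using dq le_degree by (metis antisym)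
  have orth: "jacobi_integral (\<alpha> + real j) \<beta> q = 0" if "j < m" for j
    using that assms by (subst J) (auto simp: poly_r)
  define p where "p = smult (1 / coeff q m) q"
  have "jacobi_integral \<alpha> \<beta> (monom 1 j * p) = 0" if "j < m" for j
    unfolding jacobi_integral_mult_monom p_def using assms orth[OF that]
    by (subst jacobi_integral_smult) auto
  then have "jp_type_II \<alpha> \<alpha>' \<beta> m 0 p"
    using nz deg by (simp add: jp_type_II_def p_def jacobi_integral_def poly_monom)
  then show ?thesis by (rule that)
qed

lemma jacobi_integral_pair:
  assumes "a > -1" "a' > -1" "b > -1"
  shows "integral {0..1} (\<lambda>x. poly q x * (poly p x * x powr a + poly p' x * x powr a') * (1 - x) powr b)
           = jacobi_integral a b (q * p) + jacobi_integral a' b (q * p')"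
proof -
  note integrable = jacobi_integrable[OF assms(1,3), of "q * p"] jacobi_integrable[OF assms(2,3), of "q * p'"]
  show ?thesis
    unfolding jacobi_integral_def integral_add[OF integrable, symmetric]
    by (simp add: algebra_simps)
qed

text \<open>The normalisation in the definition is stated for type II polynomials. Pairing with the
  one of index \<open>(j, 0)\<close>, where \<open>j + 1 = n1 + n2\<close>, gives the top moment,
  since that polynomial is monic and the lower moments vanish.\<close>

lemma jp_type_I_moments:
  assumes ab: "\<alpha>1 > -1" "\<alpha>2 > -1" "\<beta> > -1" and I: "jp_type_I \<alpha>1 \<alpha>2 \<beta> n1 n2 P1 P2"
    and j: "j < n1 + n2"
  shows "jacobi_integral \<alpha>1 \<beta> (monom 1 j * P1) + jacobi_integral \<alpha>2 \<beta> (monom 1 j * P2)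
           = (if j + 1 = n1 + n2 then 1 else 0)"
proof -
  have low: "jacobi_integral \<alpha>1 \<beta> (monom 1 i * P1) + jacobi_integral \<alpha>2 \<beta> (monom 1 i * P2) = 0"
    if "i + 2 \<le> n1 + n2" for i
    using I that jacobi_integral_pair[OF ab, of "monom 1 i" P1 P2]
    by (simp add: jp_type_I_def poly_monom)
  show ?thesis
  proof (cases "j + 1 = n1 + n2")
    case True
    obtain p where p: "jp_type_II \<alpha>1 \<alpha>2 \<beta> j 0 p" using monic_jacobi_exists[OF ab(1,3)] .
    then have deg: "degree p = j" "coeff p j = 1" by (auto simp: jp_type_II_def)
    have "1 = jacobi_integral \<alpha>1 \<beta> (p * P1) + jacobi_integral \<alpha>2 \<beta> (p * P2)"
      using I p True unfolding jacobi_integral_pair[OF ab, symmetric] jp_type_I_def Let_def by auto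
    also have "\<dots> = (\<Sum>i\<le>j. coeff p i * (jacobi_integral \<alpha>1 \<beta> (monom 1 i * P1)
          + jacobi_integral \<alpha>2 \<beta> (monom 1 i * P2)))"
      by (simp add: jacobi_integral_mult_expand[of _ _ p j] ab deg distrib_left sum.distrib)
    also have "\<dots> = (\<Sum>i\<in>{j}. coeff p i * (jacobi_integral \<alpha>1 \<beta> (monom 1 i * P1)
          + jacobi_integral \<alpha>2 \<beta> (monom 1 i * P2)))"
      using True by (intro sum.mono_neutral_right) (auto simp: low)
    finally show ?thesis using True deg by simp
  qed (use low j in auto)
qed

section \<open>The prefactor and its removable singularity\<close>

text \<open>Away from the poles, the first factor \<open>z\<close> of \<open>pochhammer z n\<close>
  is absorbed into \<open>Gamma (z + 1)\<close>.\<close>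

lemma jp_raw_prefactor_regular:
  fixes \<alpha> \<alpha>' \<beta> :: real and n n' :: nat
  assumes "n \<ge> 1" and "\<alpha> + \<beta> + real n + real n' \<notin> \<int>\<^sub>\<le>\<^sub>0"
  defines "z \<equiv> \<alpha> + \<beta> + real n + real n'"
  shows "jp_raw_prefactor \<alpha> \<alpha>' \<beta> n n' = (-1) ^ (n + n' - 1)
      * (pochhammer (z + 1) (n - 1) * pochhammer (\<alpha>' + \<beta> + real n + real n') n')
      / (fact (n - 1) * pochhammer (\<alpha>' - \<alpha>) n')
      * (Gamma (z + 1) / (Gamma (\<beta> + real n + real n') * Gamma (\<alpha> + 1)))"
proof -
  have "(-1 :: real) powi (int n + int n' - 1) = (-1) ^ (n + n' - 1)"
    using assms(1) by (simp add: power_int_def nat_diff_distrib nat_add_distrib)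
  moreover have "pochhammer z n = z * pochhammer (z + 1) (n - 1)"
    using assms(1) pochhammer_rec[of z "n - 1"] by simp
  moreover have "Gamma (z + 1) = z * Gamma z"
    using assms(2) unfolding z_def by (rule Gamma_plus1)
  ultimately show ?thesis
    using assms(1) by (simp add: jp_raw_prefactor_def inv_fact_pred_def z_def)
qed

text \<open>The right-hand side is continuous in \<open>\<alpha>\<close> at the only pole that can
  occur, \<open>z = 0\<close>, so the limit in the definition agrees with it.\<close>

lemma jp_prefactor_eq:
  fixes \<alpha> \<alpha>' \<beta> :: real and n n' :: nat
  assumes n: "n \<ge> 1" and ab: "\<alpha> > -1" "\<beta> > -1"
  defines "z \<equiv> \<alpha> + \<beta> + real n + real n'"
  shows "jp_prefactor \<alpha> \<alpha>' \<beta> n n' = (-1) ^ (n + n' - 1)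
      * (pochhammer (z + 1) (n - 1) * pochhammer (\<alpha>' + \<beta> + real n + real n') n')
      / (fact (n - 1) * pochhammer (\<alpha>' - \<alpha>) n')
      * (Gamma (z + 1) / (Gamma (\<beta> + real n + real n') * Gamma (\<alpha> + 1)))"
proof (cases "z \<in> \<int>\<^sub>\<le>\<^sub>0")
  case False
  then show ?thesis
    using jp_raw_prefactor_regular[OF n] by (simp add: jp_prefactor_def z_def)
next
  case True
  then obtain i where i: "z = - real i" by (auto elim!: nonpos_Ints_cases')
  have "real n + real n' < 2 - real i" using i ab by (simp add: z_def)
  then have n1: "n = 1" "n' = 0" "z = 0" using n i by auto
  \<comment> \<open>The raw prefactor near \<open>\<alpha>\<close>, with its removable singularity cancelled.\<close>
  let ?g = "\<lambda>t. Gamma (t + \<beta> + 2) / (Gamma (\<beta> + 1) * Gamma (t + 1))"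
  \<comment> \<open>Since \<open>\<alpha> + \<beta> + 1 = 0\<close>, the bound
    \<open>t > \<alpha> - 1\<close> keeps \<open>t + \<beta> + 1\<close> above \<open>-1\<close>, so
    only \<open>t = \<alpha>\<close> is a pole of its Gamma value.\<close>
  have raw: "jp_raw_prefactor t \<alpha>' \<beta> n n' = ?g t" if "t \<in> {\<alpha> - 1<..}" "t \<noteq> \<alpha>" for t
  proof -
    have "t + \<beta> + 1 > -1" "t + \<beta> + 1 \<noteq> 0" using that n1 by (auto simp: z_def)
    then have "t + \<beta> + 1 \<notin> \<int>\<^sub>\<le>\<^sub>0" by (auto elim!: nonpos_Ints_cases')
    then show ?thesis using jp_raw_prefactor_regular[of n t \<beta> n' \<alpha>'] n1 by (simp add: add_ac)
  qed
  have "\<alpha> + 1 \<notin> \<int>\<^sub>\<le>\<^sub>0" "\<beta> + 1 \<notin> \<int>\<^sub>\<le>\<^sub>0" "\<alpha> + \<beta> + 2 \<notin> \<int>\<^sub>\<le>\<^sub>0"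
    using ab by (auto elim!: nonpos_Ints_cases')
  then have "(?g \<longlongrightarrow> ?g \<alpha>) (at \<alpha>)"
    by (intro tendsto_intros) (auto simp: Gamma_eq_zero_iff)
  moreover have "\<forall>\<^sub>F t in at \<alpha>. jp_raw_prefactor t \<alpha>' \<beta> n n' = ?g t"
    using raw by (intro eventually_at_in_open[of "{\<alpha> - 1<..}", THEN eventually_mono]) auto
  ultimately have "((\<lambda>t. jp_raw_prefactor t \<alpha>' \<beta> n n') \<longlongrightarrow> ?g \<alpha>) (at \<alpha>)"
    by (simp add: tendsto_cong)
  then have "Lim (at \<alpha>) (\<lambda>t. jp_raw_prefactor t \<alpha>' \<beta> n n') = ?g \<alpha>"
    by (intro tendsto_Lim) auto
  moreover have "?g \<alpha> = Gamma (z + 1) / (Gamma (\<beta> + real n + real n') * Gamma (\<alpha> + 1))"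
    unfolding z_def using n1(1,2) by (simp add: add_ac)
  ultimately show ?thesis
    using True n1(1,2) unfolding jp_prefactor_def z_def[symmetric] by simp
qed

text \<open>\<open>inv_fact_pred 0 = 0\<close> makes the raw prefactor vanish identically, hence
  also its limit.\<close>

lemma jp_prefactor_0: "jp_prefactor \<alpha> \<alpha>' \<beta> 0 n' = 0"
  by (simp add: jp_prefactor_def jp_raw_prefactor_def inv_fact_pred_def tendsto_Lim)

section \<open>Terminating series and the explicit formulas\<close>

text \<open>For \<open>n \<ge> 1\<close> the upper parameter \<open>1 - n\<close> ends the series
  before \<open>l = n\<close>. For \<open>n = 0\<close> that parameter is \<open>1\<close> and does
  not end it, but the prefactor is \<open>0\<close>.\<close>

lemma jp_explicit_3F2_eq_sum: "jp_explicit_3F2 \<alpha> \<alpha>' \<beta> n n' x = jp_explicit_sum \<alpha> \<alpha>' \<beta> n n' x"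
proof (cases n)
  case 0
  then show ?thesis by (simp add: jp_explicit_3F2_def jp_explicit_sum_def jp_prefactor_0)
next
  case (Suc l)
  have "pochhammer (- real n + 1) i = 0" if "i \<notin> {..<n}" for i
    using that Suc by (auto simp: pochhammer_eq_0_iff intro!: exI[of _ l])
  then show ?thesis
    unfolding jp_explicit_3F2_def jp_explicit_sum_def hypergeo_3F2_def
    by (subst suminf_finite[of "{..<n}"]) (auto simp: field_simps)
qed

lemma jacobi_type_I_poly:
  assumes "\<alpha> > -1" "\<alpha>' > -1" "\<beta> > -1" and "\<alpha> - \<alpha>' \<notin> \<int>"
    and degP: "P = 0 \<or> degree P < n" and "P' = 0 \<or> degree P' < n'"
    and "\<And>j. j < n + n' \<Longrightarrow>
      jacobi_integral \<alpha> \<beta> (monom 1 j * P) + jacobi_integral \<alpha>' \<beta> (monom 1 j * P')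
        = (if j + 1 = n + n' then 1 else 0)"
  shows "poly P x = jp_explicit_sum \<alpha> \<alpha>' \<beta> n n' x"
proof (cases "n = 0")
  case True
  then show ?thesis using degP by (simp add: jp_explicit_sum_def jp_prefactor_0)
next
  case False
  then have deg: "degree P < n" using degP by auto
  have "poly P x = (\<Sum>k<n. coeff P k * x ^ k)"
    unfolding poly_altdef using deg
    by (intro sum.mono_neutral_left) (auto simp: coeff_eq_0)
  also have "\<dots> = jp_explicit_sum \<alpha> \<alpha>' \<beta> n n' x"
    unfolding jp_explicit_sum_def sum_distrib_left
    using False assms
    by (intro sum.cong refl, subst jacobi_type_I_coeff[OF assms(1-4) deg assms(6,7)])
       (simp_all add: jp_prefactor_eq mult.assoc)
  finally show ?thesis .
qed

theorem proposition3p1: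
  fixes \<alpha>1 \<alpha>2 \<beta> :: real and n1 n2 :: nat and P1 P2 :: "real poly"
  assumes "\<alpha>1 > -1" and "\<alpha>2 > -1" and "\<beta> > -1"
    and "\<alpha>1 - \<alpha>2 \<notin> \<int>"
    and "jp_type_I \<alpha>1 \<alpha>2 \<beta> n1 n2 P1 P2"
  shows "\<forall>x. poly P1 x = jp_explicit_3F2 \<alpha>1 \<alpha>2 \<beta> n1 n2 x \<and>
             poly P1 x = jp_explicit_sum \<alpha>1 \<alpha>2 \<beta> n1 n2 x \<and>
             poly P2 x = jp_explicit_3F2 \<alpha>2 \<alpha>1 \<beta> n2 n1 x \<and>
             poly P2 x = jp_explicit_sum \<alpha>2 \<alpha>1 \<beta> n2 n1 x"
proof -
  have deg: "P1 = 0 \<or> degree P1 < n1" "P2 = 0 \<or> degree P2 < n2"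
    using assms(5) by (simp_all add: jp_type_I_def)
  have nonint: "\<alpha>2 - \<alpha>1 \<notin> \<int>"
    using assms(4) by (metis Ints_minus minus_diff_eq)
  note moments = jp_type_I_moments[OF assms(1-3,5)]
  have "poly P1 x = jp_explicit_sum \<alpha>1 \<alpha>2 \<beta> n1 n2 x" for x
    by (rule jacobi_type_I_poly[OF assms(1-4) deg moments])
  moreover have "poly P2 x = jp_explicit_sum \<alpha>2 \<alpha>1 \<beta> n2 n1 x" for x
    using moments by (intro jacobi_type_I_poly[OF assms(2,1,3) nonint deg(2,1)]) (simp add: add.commute)
  ultimately show ?thesis by (simp add: jp_explicit_3F2_eq_sum)
qed

end
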